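(* Suppose the feasible region $S$ of $(QP)$ is nonempty and bounded (a nonempty polytope), and let $\mathcal{K} = \mathcal{CP}^{n+1}$. Then the function $\ell_{\mathcal{K}}(\cdot)$ is the convex envelope of $q(\cdot)$ on $S$, i.e., \[ \ell_{\mathcal{K}}(x) = f_S(x), \quad x \in S. \] Therefore, $\ell_{\mathcal{K}} = \ell^*$. In addition, for $\tilde{x} \in S$, $\ell_{\mathcal{K}}(\tilde{x}) = \ell^*$ if and only if $\tilde{x} \in \mathrm{conv}(S^* )$, where $S^*$ is the set of optimal solutions of $(QP)$.
   Context: Quadratic program: let $Q \in \mathbb{R}^{n\times n}$ be symmetric, $c \in \mathbb{R}^n$, $A \in \mathbb{R}^{m \times n}$, $b \in \mathbb{R}^m$; put $q(x) = x^T Q x + 2c^T x$ and $S = \{x \in \mathbb{R}^n : Ax = b,\ x \ge 0\}$. $(QP)$ is the problem of minimizing $q(x)$ over $x \in S$, with optimal value $\ell^*$. $S^* = \{x^* \in S : q(x^* ) = \ell^*\}$. $\mathcal{S}^N$ denotes the real symmetric $N\times N$ matrices, and $\langle U,V\rangle = \sum_{i,j} U_{ij}V_{ij}$. The cone of completely positive matrices is $\mathcal{CP}^N = \{\sum_{j=1}^k y^j (y^j)^T : k \ge 1,\ y^j \in \mathbb{R}^N_+\}$. Rows and columns of matrices in $\mathcal{S}^{n+1}$ are indexed by $0,1,\ldots,n$. Let \[ \widehat{Q} = \begin{bmatrix} 0 & c^T \\ c & Q\end{bmatrix}, \qquad \widehat{A} = \begin{bmatrix} b^Tb & -b^TA \\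 -A^Tb & A^TA\end{bmatrix}. \] $(P(\mathcal{K}))$: minimize $\langle \widehat{Q}, Y\rangle$ subject to $\langle \widehat{A}, Y\rangle = 0$, $Y_{00} = 1$, $Y \in \mathcal{K}$; its optimal value (infimum) is $\ell_{\mathcal{K}}$. For $\tilde{x} \in S$, $(P(\mathcal{K},\tilde{x}))$ is the same problem with the additional constraint that $(Y_{01},\ldots,Y_{0n}) = \tilde{x}^T$; its optimal value (infimum) is $\ell_{\mathcal{K}}(\tilde{x})$. A convex underestimator of $q$ on $S$ is a convex function $g : \mathbb{R}^n \to \mathbb{R}$ with $g(x) \le q(x)$ for all $x \in S$. The convex envelope of $q$ on $S$ is $f_S(x) = \sup\{g(x) : g \text{ is a convex underestimator of } q \text{ on } S\}$, $x \in S$. *)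

theory Defs
  imports "HOL-Analysis.Analysis"
begin

text \<open>
  Vectors in n-space have type \<open>real ^ 'n\<close>. The index set \<open>0, 1, \<dots>, n\<close> of matrices
  of order n + 1 is the type \<open>'n option\<close>: \<open>None\<close> is the index 0 and \<open>Some i\<close> is the
  index i. Optimal values are infima in \<open>ereal\<close>, so that infeasible and unbounded
  problems have values \<open>\<infinity>\<close> and \<open>-\<infinity>\<close>. The trace inner product of matrices is
  \<open>\<bullet>\<close>, which on \<open>real ^ 'k ^ 'l\<close> is the sum of all products of corresponding entries.
\<close>

definition qp_obj :: "real ^ 'n ^ 'n \<Rightarrow> real ^ 'n \<Rightarrow> real ^ 'n \<Rightarrow> real" where
  "qp_obj Q c x = x \<bullet> (Q *v x) + 2 * (c \<bullet> x)"

definition qp_feasible :: "real ^ 'n ^ 'm \<Rightarrow> real ^ 'm \<Rightarrow> (real ^ 'n) set" where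
  "qp_feasible A b = {x. A *v x = b \<and> (\<forall>i. 0 \<le> x $ i)}"

definition qp_value ::
  "real ^ 'n ^ 'n \<Rightarrow> real ^ 'n \<Rightarrow> real ^ 'n ^ 'm \<Rightarrow> real ^ 'm \<Rightarrow> ereal" where
  "qp_value Q c A b = (INF x\<in>qp_feasible A b. ereal (qp_obj Q c x))"

definition qp_solutions ::
  "real ^ 'n ^ 'n \<Rightarrow> real ^ 'n \<Rightarrow> real ^ 'n ^ 'm \<Rightarrow> real ^ 'm \<Rightarrow> (real ^ 'n) set" where
  "qp_solutions Q c A b =
     {x \<in> qp_feasible A b. ereal (qp_obj Q c x) = qp_value Q c A b}"

definition outer_square :: "real ^ 'k \<Rightarrow> real ^ 'k ^ 'k" where
  "outer_square y = (\<chi> i j. y $ i * y $ j)"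

definition completely_positive :: "(real ^ 'k ^ 'k) set" where
  "completely_positive =
     {\<Sum>j=1..k. outer_square (y j) | (k::nat) (y :: nat \<Rightarrow> real ^ 'k).
        k \<ge> 1 \<and> (\<forall>j\<in>{1..k}. \<forall>i. 0 \<le> y j $ i)}"

text \<open>The matrix with top-left entry \<open>a\<close>, rest of row 0 \<open>r\<close>, rest of column 0 \<open>s\<close>,
  and lower right block \<open>M\<close>.\<close>

definition bordered ::
  "real \<Rightarrow> real ^ 'n \<Rightarrow> real ^ 'n \<Rightarrow> real ^ 'n ^ 'n \<Rightarrow> real ^ 'n option ^ 'n option" where
  "bordered a r s M = (\<chi> i j.
     (case i of
        None \<Rightarrow> (case j of None \<Rightarrow> a | Some l \<Rightarrow> r $ l)
      | Some k \<Rightarrow> (case j of None \<Rightarrow> s $ k | Some l \<Rightarrow> M $ k $ l)))"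

definition Q_hat :: "real ^ 'n ^ 'n \<Rightarrow> real ^ 'n \<Rightarrow> real ^ 'n option ^ 'n option" where
  "Q_hat Q c = bordered 0 c c Q"

definition A_hat :: "real ^ 'n ^ 'm \<Rightarrow> real ^ 'm \<Rightarrow> real ^ 'n option ^ 'n option" where
  "A_hat A b =
     bordered (b \<bullet> b) (- (b v* A)) (- (transpose A *v b)) (transpose A ** A)"

definition conic_feasible ::
  "(real ^ 'n option ^ 'n option) set \<Rightarrow> real ^ 'n ^ 'm \<Rightarrow> real ^ 'm
     \<Rightarrow> (real ^ 'n option ^ 'n option) set" where
  "conic_feasible K A b = {Y \<in> K. A_hat A b \<bullet> Y = 0 \<and> Y $ None $ None = 1}"

definition conic_value ::
  "(real ^ 'n option ^ 'n option) set \<Rightarrow> real ^ 'n ^ 'n \<Rightarrow> real ^ 'n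
     \<Rightarrow> real ^ 'n ^ 'm \<Rightarrow> real ^ 'm \<Rightarrow> ereal" where
  "conic_value K Q c A b = (INF Y\<in>conic_feasible K A b. ereal (Q_hat Q c \<bullet> Y))"

definition conic_value_at ::
  "(real ^ 'n option ^ 'n option) set \<Rightarrow> real ^ 'n ^ 'n \<Rightarrow> real ^ 'n
     \<Rightarrow> real ^ 'n ^ 'm \<Rightarrow> real ^ 'm \<Rightarrow> real ^ 'n \<Rightarrow> ereal" where
  "conic_value_at K Q c A b x =
     (INF Y\<in>{Y \<in> conic_feasible K A b. \<forall>i. Y $ None $ Some i = x $ i}.
        ereal (Q_hat Q c \<bullet> Y))"

definition convex_underestimator ::
  "'a::real_vector set \<Rightarrow> ('a \<Rightarrow> real) \<Rightarrow> ('a \<Rightarrow> real) \<Rightarrow> bool" where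
  "convex_underestimator S q g \<longleftrightarrow> convex_on UNIV g \<and> (\<forall>x\<in>S. g x \<le> q x)"

definition convex_envelope ::
  "'a::real_vector set \<Rightarrow> ('a \<Rightarrow> real) \<Rightarrow> 'a \<Rightarrow> ereal" where
  "convex_envelope S q x = (SUP g\<in>{g. convex_underestimator S q g}. ereal (g x))"

end

theory Submission imports Defs begin

text \<open>
  Writing the factors of a feasible completely positive matrix as \<open>y = (t, z)\<close>, the constraint
  \<open>\<langle>A_hat, Y\<rangle> = 0\<close> says that \<open>A z = t b\<close> for every factor. As \<open>S\<close> is nonempty and bounded it
  has no nonzero recession direction, so \<open>z = t x\<close> with \<open>x \<in> S\<close> in all cases. Hence
  the pairs formed by row 0 and the objective value of feasible matrices are exactly the points
  of the convex hull of the graph of \<open>q\<close> over \<open>S\<close>. This hull is compact, its lower boundary is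
  the convex envelope (separate a point below it by a hyperplane), and its
  points at the minimal height \<open>\<ell>\<^sup>*\<close> lie over the convex hull of the minimizers.
\<close>

section \<open>The convex hull of a graph\<close>

lemma convex_on_affine: "convex_on UNIV (\<lambda>y. k + a \<bullet> y)"
  by (rule convex_onI) (auto simp: inner_right_distrib algebra_simps)

text \<open>The epigraph of \<open>g\<close> is convex and contains the graph of \<open>q\<close>
  over \<open>S\<close>, hence also the hull of that graph.\<close>

lemma convex_on_le_snd_convex_hull_graph:
  fixes g q :: "'a::real_vector \<Rightarrow> real"
  assumes "convex_on UNIV g" "\<And>y. y \<in> S \<Longrightarrow> g y \<le> q y"
    and "(x, v) \<in> convex hull ((\<lambda>y. (y, q y)) ` S)"
  shows "g x \<le> v"
proof -
  have "convex (epigraph UNIV g)"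
    using assms(1) by (simp add: convex_epigraph)
  moreover have "(\<lambda>y. (y, q y)) ` S \<subseteq> epigraph UNIV g"
    using assms(2) by (auto simp: epigraph_def)
  ultimately have "convex hull ((\<lambda>y. (y, q y)) ` S) \<subseteq> epigraph UNIV g"
    by (rule hull_minimal[rotated])
  then show ?thesis
    using assms(3) by (auto simp: epigraph_def)
qed

lemma compact_convex_hull_graph:
  fixes q :: "'a::euclidean_space \<Rightarrow> real"
  assumes "compact S" "continuous_on S q"
  shows "compact (convex hull ((\<lambda>y. (y, q y)) ` S))"
  using assms by (intro compact_convex_hull compact_continuous_image continuous_intros)

text \<open>Convex underestimators stay below the hull, which gives one inequality. For the other,
  suppose a real \<open>r\<close> bounds the envelope at \<open>x\<close> but lies below the
  infimum. The vertical ray below \<open>(x, r)\<close> then misses the compact hull, and a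
  hyperplane strictly between them is the graph of an affine underestimator exceeding
  \<open>r\<close> at \<open>x\<close>.\<close>

lemma convex_envelope_eq_INF_convex_hull_graph:
  fixes q :: "'a::euclidean_space \<Rightarrow> real"
  assumes "compact S" "continuous_on S q" "x \<in> S"
  shows "convex_envelope S q x
    = (INF v\<in>{v. (x, v) \<in> convex hull ((\<lambda>y. (y, q y)) ` S)}. ereal v)"
    (is "_ = (INF v\<in>{v. (x, v) \<in> ?G}. ereal v)")
proof (rule antisym)
  show "convex_envelope S q x \<le> (INF v\<in>{v. (x, v) \<in> ?G}. ereal v)"
    unfolding convex_envelope_def convex_underestimator_def
    by (intro SUP_least INF_greatest)
      (auto intro: convex_on_le_snd_convex_hull_graph)
  show "(INF v\<in>{v. (x, v) \<in> ?G}. ereal v) \<le> convex_envelope S q x"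
  proof (rule ereal_le_real, rule ccontr)
    fix r
    assume r: "convex_envelope S q x \<le> ereal r"
      and "\<not> (INF v\<in>{v. (x, v) \<in> ?G}. ereal v) \<le> ereal r"
    then have above: "r < v" if "(x, v) \<in> ?G" for v
      using that by (metis (mono_tags, lifting) INF_lower ereal_less_eq(3) leI
          mem_Collect_eq order_trans)
    have graph: "(y, q y) \<in> ?G" if "y \<in> S" for y
      using that by (intro hull_inc) auto
    have "compact ?G"
      using assms by (intro compact_convex_hull_graph)
    moreover have "?G \<noteq> {}"
      using graph assms(3) by blast
    moreover have "{x} \<times> {..r} \<inter> ?G = {}"
      using above by (fastforce simp: not_less[symmetric])
    moreover have "closed ({x} \<times> {..r})" "convex ({x} \<times> {..r})"
      by (auto intro: closed_Times convex_Times)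
    ultimately obtain p e where
      low: "\<forall>z\<in>{x} \<times> {..r}. p \<bullet> z < e" and up: "\<forall>z\<in>?G. e < p \<bullet> z"
      using separating_hyperplane_closed_compact[of "{x} \<times> {..r}" ?G] by auto
    obtain a \<beta> where p: "p = (a, \<beta>)"
      by (cases p)
    have low': "a \<bullet> x + \<beta> * s < e" if "s \<le> r" for s
      using low that by (auto simp: p)
    have up': "e < a \<bullet> y + \<beta> * q y" if "y \<in> S" for y
      using up graph[OF that] by (auto simp: p)
    \<comment> \<open>Comparing \<open>(x, r)\<close> with \<open>(x, q x)\<close>, which differ
      only in height, shows that the hyperplane is not vertical and that the hull lies above
      it.\<close>
    have "0 < \<beta> * (q x - r)"
      using low'[of r] up'[OF assms(3)] by (simp add: algebra_simps)
    moreover have "r < q x"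
      using above graph assms(3) by blast
    ultimately have pos: "\<beta> > 0"
      by (simp add: zero_less_mult_iff)
    \<comment> \<open>The value \<open>g y\<close> is the height of the hyperplane over
      \<open>y\<close>, the solution \<open>s\<close> of
      \<open>a \<bullet> y + \<beta> * s = e\<close>.\<close>
    define g where "g y = e / \<beta> + (- (1 / \<beta>) *\<^sub>R a) \<bullet> y" for y
    have g_eq: "g y = (e - a \<bullet> y) / \<beta>" for y
      by (simp add: g_def diff_divide_distrib)
    have "convex_on UNIV g"
      unfolding g_def by (rule convex_on_affine)
    moreover have "g y \<le> q y" if "y \<in> S" for y
      using up'[OF that] pos by (simp add: g_eq field_simps)
    ultimately have "ereal (g x) \<le> convex_envelope S q x"
      unfolding convex_envelope_def convex_underestimator_def by (intro SUP_upper) auto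
    with r have "g x \<le> r"
      using order_trans ereal_less_eq(3) by blast
    with low'[of r] pos show False
      by (simp add: g_eq field_simps)
  qed
qed

text \<open>The fibre of the compact hull over \<open>x\<close> is compact, and it contains
  \<open>q x\<close>, so its infimum is attained.\<close>

lemma ex_least_convex_hull_graph:
  fixes q :: "'a::euclidean_space \<Rightarrow> real"
  assumes "compact S" "continuous_on S q" "x \<in> S"
  shows "\<exists>v. (x, v) \<in> convex hull ((\<lambda>y. (y, q y)) ` S)
    \<and> (INF w\<in>{w. (x, w) \<in> convex hull ((\<lambda>y. (y, q y)) ` S)}. ereal w) = ereal v"
    (is "\<exists>v. (x, v) \<in> ?G \<and> _ v")
proof -
  have "compact (?G \<inter> ({x} \<times> UNIV))"
    by (intro compact_Int_closed compact_convex_hull_graph assms closed_Times) auto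
  then have "compact (snd ` (?G \<inter> ({x} \<times> UNIV)))"
    by (intro compact_continuous_image continuous_intros)
  moreover have "snd ` (?G \<inter> ({x} \<times> UNIV)) = {v. (x, v) \<in> ?G}"
    by force
  moreover have "(x, q x) \<in> ?G"
    using assms(3) by (intro hull_inc) auto
  ultimately obtain v where v: "(x, v) \<in> ?G" "\<And>w. (x, w) \<in> ?G \<Longrightarrow> v \<le> w"
    using compact_attains_inf[of "{v. (x, v) \<in> ?G}"] by auto
  then have "(INF w\<in>{w. (x, w) \<in> ?G}. ereal w) = ereal v"
    by (intro antisym INF_lower2[of v] INF_greatest) auto
  with v show ?thesis by blast
qed

text \<open>An average of heights that are all at least \<open>l\<close> equals \<open>l\<close>
  only if every height with positive weight equals \<open>l\<close>.\<close>

lemma convex_hull_graph_at_minimum: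
  fixes q :: "'a::real_vector \<Rightarrow> real"
  assumes "\<And>y. y \<in> S \<Longrightarrow> l \<le> q y"
  shows "(x, l) \<in> convex hull ((\<lambda>y. (y, q y)) ` S) \<longleftrightarrow> x \<in> convex hull {y \<in> S. q y = l}"
    (is "_ \<in> ?G \<longleftrightarrow> x \<in> ?M")
proof
  \<comment> \<open>Strictly above height \<open>l\<close> the base point is unrestricted; only the
    bottom level is confined to \<open>?M\<close>. Convexity of \<open>C\<close> then carries this
    property from the graph to its hull.\<close>
  define C where "C = {(y, w). l \<le> w \<and> (w = l \<longrightarrow> y \<in> ?M)}"
  have "convex C"
  proof (rule convexI)
    fix p p' :: "'a \<times> real" and u v :: real
    assume uv: "p \<in> C" "p' \<in> C" "0 \<le> u" "0 \<le> v" "u + v = 1"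
    obtain y w y' w' where [simp]: "p = (y, w)" "p' = (y', w')"
      by (cases p, cases p')
    show "u *\<^sub>R p + v *\<^sub>R p' \<in> C"
    \<comment> \<open>A point of weight zero may lie above height \<open>l\<close> even when the
      combination does not, so this case is split off.\<close>
    proof (cases "u = 0 \<or> v = 0")
      case True
      with uv show ?thesis by auto
    next
      case False
      with uv have pos: "0 < u" "0 < v" by auto
      have w: "l \<le> w" "l \<le> w'"
        using uv by (auto simp: C_def)
      \<comment> \<open>The excess over \<open>l\<close> becomes a sum of two nonnegative terms,
        both of which vanish when the combination has height \<open>l\<close>.\<close>
      have "u * (w - l) + v * (w' - l) = u * w + v * w' - (u + v) * l"
        by (simp add: algebra_simps)
      then have eq: "u * w + v * w' - l = u * (w - l) + v * (w' - l)"
        using uv(5) by simp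
      have nonneg: "0 \<le> u * (w - l)" "0 \<le> v * (w' - l)"
        using pos w by auto
      then have "l \<le> u * w + v * w'"
        using eq by linarith
      moreover have "u *\<^sub>R y + v *\<^sub>R y' \<in> ?M" if "u * w + v * w' = l"
      proof -
        have "u * (w - l) = 0" "v * (w' - l) = 0"
          using that eq nonneg by linarith+
        then have "w = l" "w' = l"
          using pos by auto
        then have "y \<in> ?M" "y' \<in> ?M"
          using uv by (auto simp: C_def)
        then show ?thesis
          using uv convex_convex_hull convexD by metis
      qed
      ultimately show ?thesis
        by (simp add: C_def)
    qed
  qed
  moreover have "(\<lambda>y. (y, q y)) ` S \<subseteq> C"
    using assms by (auto simp: C_def intro!: hull_inc)
  ultimately have "?G \<subseteq> C"
    by (rule hull_minimal[rotated])
  moreover assume "(x, l) \<in> ?G"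
  ultimately show "x \<in> ?M"
    by (auto simp: C_def)
next
  assume "x \<in> ?M"
  then have "(x, l) \<in> convex hull ({y \<in> S. q y = l} \<times> {l})"
    by (simp add: convex_hull_Times)
  moreover have "{y \<in> S. q y = l} \<times> {l} \<subseteq> (\<lambda>y. (y, q y)) ` S"
    by auto
  ultimately show "(x, l) \<in> ?G"
    using hull_mono by blast
qed

section \<open>Feasible completely positive matrices\<close>

definition bordered_vec :: "real \<Rightarrow> real ^ 'n \<Rightarrow> real ^ 'n option" where
  "bordered_vec t z = (\<chi> i. case i of None \<Rightarrow> t | Some k \<Rightarrow> z $ k)"

lemma bordered_vec_nth [simp]:
  "bordered_vec t z $ None = t" "bordered_vec t z $ Some k = z $ k"
  by (simp_all add: bordered_vec_def)

lemma bordered_vec_cases: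
  obtains t z where "y = bordered_vec t z"
proof
  show "y = bordered_vec (y $ None) (\<chi> k. y $ Some k)"
    by (simp add: vec_eq_iff bordered_vec_def split: option.split)
qed

lemma sum_UNIV_option:
  fixes f :: "'a::finite option \<Rightarrow> 'b::comm_monoid_add"
  shows "sum f UNIV = f None + (\<Sum>k\<in>UNIV. f (Some k))"
  by (simp add: UNIV_option_conv sum.reindex)

text \<open>The inner product of a matrix with \<open>outer_square y\<close> is its quadratic form
  at \<open>y\<close>, here expanded in blocks.\<close>

lemma bordered_inner_outer_square:
  "bordered a r s M \<bullet> outer_square (bordered_vec t z)
    = a * t\<^sup>2 + t * (r \<bullet> z) + t * (s \<bullet> z) + z \<bullet> (M *v z)"
  by (simp add: inner_vec_def bordered_def outer_square_def sum_UNIV_option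
      matrix_vector_mult_def sum.distrib sum_distrib_left power2_eq_square algebra_simps)

lemma Q_hat_inner_outer_square:
  "Q_hat Q c \<bullet> outer_square (bordered_vec t (t *\<^sub>R x)) = t\<^sup>2 * qp_obj Q c x"
  by (simp add: Q_hat_def bordered_inner_outer_square qp_obj_def power2_eq_square
      matrix_vector_mult_scaleR algebra_simps)

text \<open>\<open>A_hat A b\<close> is the Gram matrix of the columns of the block matrix
  \<open>[-b, A]\<close>, which maps \<open>(t, z)\<close> to
  \<open>A *v z - t *\<^sub>R b\<close>.\<close>

lemma A_hat_inner_outer_square:
  "A_hat A b \<bullet> outer_square (bordered_vec t z) = (norm (A *v z - t *\<^sub>R b))\<^sup>2"
proof -
  have "z \<bullet> (transpose A ** A *v z) = (A *v z) \<bullet> (A *v z)"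
    by (metis dot_lmul_matrix matrix_vector_mul_assoc vector_transpose_matrix
        transpose_matrix_vector inner_commute)
  moreover have "(b v* A) \<bullet> z = b \<bullet> (A *v z)"
    by (rule dot_lmul_matrix)
  ultimately show ?thesis
    unfolding A_hat_def bordered_inner_outer_square power2_norm_eq_inner
    by (simp add: inner_diff_left inner_diff_right inner_commute power2_eq_square algebra_simps)
qed

text \<open>A nonzero \<open>z\<close> would be a recession direction: the whole ray from
  \<open>x\<close> along \<open>z\<close> would be feasible, against boundedness.\<close>

lemma qp_feasible_recession_zero:
  assumes "x \<in> qp_feasible A b" "bounded (qp_feasible A b)"
    and "A *v z = 0" "\<And>i. 0 \<le> z $ i"
  shows "z = 0"
proof (rule ccontr)
  assume "z \<noteq> 0"
  obtain B where B: "\<And>y. y \<in> qp_feasible A b \<Longrightarrow> norm y \<le> B"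
    using assms(2) by (auto simp: bounded_iff)
  \<comment> \<open>With this step length \<open>s *\<^sub>R z\<close> has norm greater than
    \<open>B + norm x\<close>, so \<open>x + s *\<^sub>R z\<close> leaves the ball of radius
    \<open>B\<close>.\<close>
  define s where "s = (\<bar>B\<bar> + norm x + 1) / norm z"
  have "s > 0"
    using \<open>z \<noteq> 0\<close> by (simp add: s_def divide_pos_pos add_nonneg_pos)
  then have "x + s *\<^sub>R z \<in> qp_feasible A b"
    using assms by (simp add: qp_feasible_def matrix_vector_right_distrib matrix_vector_mult_scaleR)
  then have "norm (x + s *\<^sub>R z) \<le> B"
    by (rule B)
  moreover have "norm (s *\<^sub>R z) = \<bar>B\<bar> + norm x + 1"
    using \<open>z \<noteq> 0\<close> \<open>s > 0\<close> by (simp add: s_def)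
  moreover have "norm (s *\<^sub>R z) \<le> norm (x + s *\<^sub>R z) + norm x"
    using norm_triangle_ineq4[of "x + s *\<^sub>R z" x] by simp
  ultimately show False by linarith
qed

text \<open>For positive \<open>t\<close> take \<open>x = z / t\<close>. For \<open>t = 0\<close>
  the vector \<open>z\<close> is a recession direction, hence zero, and any feasible
  \<open>x\<close> serves.\<close>

lemma qp_feasible_homogenized:
  assumes "qp_feasible A b \<noteq> {}" "bounded (qp_feasible A b)"
    and "A *v z = t *\<^sub>R b" "0 \<le> t" "\<And>i. 0 \<le> z $ i"
  obtains x where "x \<in> qp_feasible A b" "z = t *\<^sub>R x"
proof (cases "t = 0")
  case True
  then have "z = 0"
    using qp_feasible_recession_zero assms by (metis all_not_in_conv scaleR_zero_left)
  with True that assms(1) show ?thesis by auto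
next
  case False
  with assms have "(1 / t) *\<^sub>R z \<in> qp_feasible A b"
    by (simp add: qp_feasible_def matrix_vector_mult_scaleR)
  with False that show ?thesis
    by (metis divide_self_if scaleR_one scaleR_scaleR times_divide_eq_right mult.right_neutral)
qed

definition row0 :: "real ^ 'n option ^ 'n option \<Rightarrow> real ^ 'n" where
  "row0 Y = (\<chi> i. Y $ None $ Some i)"

lemma row0_eq_iff: "row0 Y = x \<longleftrightarrow> (\<forall>i. Y $ None $ Some i = x $ i)"
  by (simp add: row0_def vec_eq_iff)

lemma row0_sum: "row0 (sum f I) = (\<Sum>j\<in>I. row0 (f j))"
  by (simp add: row0_def vec_eq_iff)

lemma row0_outer_square: "row0 (outer_square (bordered_vec t (t *\<^sub>R x))) = t\<^sup>2 *\<^sub>R x"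
  by (simp add: row0_def outer_square_def vec_eq_iff power2_eq_square)

text \<open>A factor \<open>t (1, x)\<close> with \<open>x\<close> feasible contributes
  \<open>t\<^sup>2 (x, q(x))\<close> to the pair of row 0 and objective, and
  \<open>t\<^sup>2\<close> to the corner entry. Corner entry 1 therefore turns the squares into
  convex weights; conversely, weights \<open>u j\<close> arise from factors scaled by
  \<open>sqrt (u j)\<close>.\<close>

lemma conic_feasible_image_eq_convex_hull_graph:
  assumes "qp_feasible A b \<noteq> {}" "bounded (qp_feasible A b)"
  shows "(\<lambda>Y. (row0 Y, Q_hat Q c \<bullet> Y)) ` conic_feasible completely_positive A b
    = convex hull ((\<lambda>x. (x, qp_obj Q c x)) ` qp_feasible A b)" (is "?L = ?G")
proof (intro equalityI subsetI)
  fix p assume "p \<in> ?L"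
  then obtain Y where Y: "Y \<in> completely_positive" "A_hat A b \<bullet> Y = 0" "Y $ None $ None = 1"
    and p: "p = (row0 Y, Q_hat Q c \<bullet> Y)"
    by (auto simp: conic_feasible_def)
  from Y(1) obtain k and y :: "nat \<Rightarrow> _" where Y_sum: "Y = (\<Sum>j=1..k. outer_square (y j))"
    and y: "\<And>j i. j \<in> {1..k} \<Longrightarrow> 0 \<le> y j $ i"
    unfolding completely_positive_def by blast
  \<comment> \<open>Since each factor contributes a squared norm, the single equation on
    \<open>Y\<close> splits into one equation per factor.\<close>
  have sq: "0 \<le> A_hat A b \<bullet> outer_square v" for v
    by (cases v rule: bordered_vec_cases) (simp add: A_hat_inner_outer_square)
  have zero: "A_hat A b \<bullet> outer_square (y j) = 0" if "j \<in> {1..k}" for j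
    using Y(2) sq that
      sum_nonneg_eq_0_iff[of "{1..k}" "\<lambda>j. A_hat A b \<bullet> outer_square (y j)"]
    by (simp add: Y_sum inner_sum_right)
  have "\<exists>t x. x \<in> qp_feasible A b \<and> y j = bordered_vec t (t *\<^sub>R x)" if j: "j \<in> {1..k}" for j
  proof -
    obtain t z where tz: "y j = bordered_vec t z"
      by (rule bordered_vec_cases)
    have "A *v z = t *\<^sub>R b"
      using zero[OF j] by (simp add: tz A_hat_inner_outer_square)
    moreover have "0 \<le> t" "\<And>i. 0 \<le> z $ i"
      using y[OF j, of None] y[OF j, of "Some _"] by (simp_all add: tz)
    ultimately obtain x where "x \<in> qp_feasible A b" "z = t *\<^sub>R x"
      using qp_feasible_homogenized[OF assms] by metis
    with tz show ?thesis by blast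
  qed
  then obtain t x where tx: "\<And>j. j \<in> {1..k} \<Longrightarrow> x j \<in> qp_feasible A b"
    "\<And>j. j \<in> {1..k} \<Longrightarrow> y j = bordered_vec (t j) (t j *\<^sub>R x j)"
    by metis
  have "(\<Sum>j=1..k. (t j)\<^sup>2) = Y $ None $ None"
    by (simp add: Y_sum tx(2) outer_square_def power2_eq_square)
  then have one: "(\<Sum>j=1..k. (t j)\<^sup>2) = 1"
    using Y(3) by simp
  have "p = (\<Sum>j=1..k. (t j)\<^sup>2 *\<^sub>R (x j, qp_obj Q c (x j)))"
    by (simp add: p Y_sum tx(2) row0_sum row0_outer_square inner_sum_right
        Q_hat_inner_outer_square sum_prod)
  also have "\<dots> \<in> ?G"
    using tx(1) one by (intro convex_sum) (auto intro!: hull_inc)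
  finally show "p \<in> ?G" .
next
  fix p assume "p \<in> ?G"
  then obtain k u w where w: "\<forall>j\<in>{1::nat..k}. 0 \<le> u j
      \<and> w j \<in> (\<lambda>x. (x, qp_obj Q c x)) ` qp_feasible A b"
    and one: "sum u {1..k} = 1" and p: "p = (\<Sum>j=1..k. u j *\<^sub>R w j)"
    unfolding convex_hull_indexed by blast
  define x where "x j = fst (w j)" for j
  have x: "x j \<in> qp_feasible A b" "w j = (x j, qp_obj Q c (x j))" if "j \<in> {1..k}" for j
    using bspec[OF w that] by (auto simp: x_def)
  define y where "y j = bordered_vec (sqrt (u j)) (sqrt (u j) *\<^sub>R x j)" for j
  define Y where "Y = (\<Sum>j=1..k. outer_square (y j))"
  \<comment> \<open>An empty family of weights would sum to 0 instead of 1.\<close>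
  have "k \<ge> 1"
    using one by (cases k) auto
  moreover have "0 \<le> y j $ i" if "j \<in> {1..k}" for j i
    using x(1)[OF that] w that
    by (cases i) (auto simp: y_def qp_feasible_def)
  ultimately have "Y \<in> completely_positive"
    unfolding completely_positive_def Y_def by blast
  moreover have "A_hat A b \<bullet> Y = 0"
    using x(1) by (simp add: Y_def y_def inner_sum_right A_hat_inner_outer_square
        matrix_vector_mult_scaleR qp_feasible_def)
  moreover have "Y $ None $ None = 1"
    using w one by (simp add: Y_def y_def outer_square_def)
  moreover have "p = (row0 Y, Q_hat Q c \<bullet> Y)"
    using w by (simp add: p x(2) Y_def y_def row0_sum row0_outer_square inner_sum_right
        Q_hat_inner_outer_square sum_prod)
  ultimately show "p \<in> ?L"
    by (auto simp: conic_feasible_def)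
qed

section \<open>Optimal values read off from the hull\<close>

lemma conic_value_at_eq_INF_convex_hull_graph:
  assumes "qp_feasible A b \<noteq> {}" "bounded (qp_feasible A b)"
  shows "conic_value_at completely_positive Q c A b x
    = (INF v\<in>{v. (x, v) \<in> convex hull ((\<lambda>x. (x, qp_obj Q c x)) ` qp_feasible A b)}. ereal v)"
proof -
  have "(\<lambda>Y. ereal (Q_hat Q c \<bullet> Y)) ` {Y \<in> conic_feasible completely_positive A b.
        \<forall>i. Y $ None $ Some i = x $ i}
      = ereal ` {v. (x, v) \<in> (\<lambda>Y. (row0 Y, Q_hat Q c \<bullet> Y))
          ` conic_feasible completely_positive A b}"
    unfolding row0_eq_iff[symmetric] by auto
  then show ?thesis
    by (simp add: conic_value_at_def conic_feasible_image_eq_convex_hull_graph[OF assms])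
qed

lemma conic_value_eq_INF_convex_hull_graph:
  assumes "qp_feasible A b \<noteq> {}" "bounded (qp_feasible A b)"
  shows "conic_value completely_positive Q c A b
    = (INF p\<in>convex hull ((\<lambda>x. (x, qp_obj Q c x)) ` qp_feasible A b). ereal (snd p))"
  unfolding conic_value_def conic_feasible_image_eq_convex_hull_graph[OF assms, symmetric]
  by (simp add: image_image)

lemma compact_qp_feasible:
  assumes "bounded (qp_feasible A b)"
  shows "compact (qp_feasible A b)"
proof -
  have "qp_feasible A b = {x. A *v x = b} \<inter> (\<Inter>i. {x. 0 \<le> x $ i})"
    by (auto simp: qp_feasible_def)
  also have "closed \<dots>"
    by (intro closed_Int closed_INT ballI closed_Collect_eq closed_Collect_le continuous_intros)
  finally show ?thesis
    using assms by (simp add: compact_eq_bounded_closed)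
qed

lemma continuous_on_qp_obj: "continuous_on S (qp_obj Q c)"
  unfolding qp_obj_def by (intro continuous_intros)

theorem proposition5p4:
  fixes Q :: "real ^ 'n ^ 'n" and c :: "real ^ 'n"
    and A :: "real ^ 'n ^ 'm" and b :: "real ^ 'm"
  assumes "transpose Q = Q"
    and "qp_feasible A b \<noteq> {}"
    and "bounded (qp_feasible A b)"
  shows "(\<forall>x\<in>qp_feasible A b.
            conic_value_at completely_positive Q c A b x
              = convex_envelope (qp_feasible A b) (qp_obj Q c) x)
       \<and> conic_value completely_positive Q c A b = qp_value Q c A b
       \<and> (\<forall>x\<in>qp_feasible A b.
            conic_value_at completely_positive Q c A b x = qp_value Q c A b
              \<longleftrightarrow> x \<in> convex hull (qp_solutions Q c A b))"
proof -
  define S where "S = qp_feasible A b"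
  define q where "q = qp_obj Q c"
  define G where "G = convex hull ((\<lambda>x. (x, q x)) ` S)"
  have S: "compact S" "S \<noteq> {}" and q: "continuous_on S q"
    using assms(2,3) by (simp_all add: S_def q_def compact_qp_feasible continuous_on_qp_obj)
  have val: "conic_value_at completely_positive Q c A b x = (INF v\<in>{v. (x, v) \<in> G}. ereal v)" for x
    using conic_value_at_eq_INF_convex_hull_graph[OF assms(2,3)] by (simp add: G_def S_def q_def)
  obtain x0 where x0: "x0 \<in> S" "\<And>y. y \<in> S \<Longrightarrow> q x0 \<le> q y"
    using continuous_attains_inf[OF S q] by blast
  have opt: "qp_value Q c A b = ereal (q x0)"
    unfolding qp_value_def S_def[symmetric] q_def[symmetric]
    using x0 by (intro antisym INF_lower2[of x0] INF_greatest) auto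
  \<comment> \<open>The constant function \<open>q x0\<close> is itself a convex underestimator, so
    no point of the hull lies below the minimum.\<close>
  have lower: "q x0 \<le> v" if "(x, v) \<in> G" for x v
    using convex_on_le_snd_convex_hull_graph[of "\<lambda>_. q x0" S q x v] x0 that
    by (simp add: G_def convex_on_def flip: distrib_right)
  have "conic_value completely_positive Q c A b = (INF p\<in>G. ereal (snd p))"
    using conic_value_eq_INF_convex_hull_graph[OF assms(2,3)] by (simp add: G_def S_def q_def)
  also have "\<dots> = ereal (q x0)"
    using lower x0(1)
    by (intro antisym INF_lower2[of "(x0, q x0)"] INF_greatest) (auto simp: G_def intro!: hull_inc)
  finally have global: "conic_value completely_positive Q c A b = qp_value Q c A b"
    by (simp add: opt)
  have sol: "qp_solutions Q c A b = {y \<in> S. q y = q x0}"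
    by (simp add: qp_solutions_def opt S_def q_def)
  have "conic_value_at completely_positive Q c A b x = qp_value Q c A b
      \<longleftrightarrow> x \<in> convex hull (qp_solutions Q c A b)" if "x \<in> S" for x
  proof -
    obtain v where v: "(x, v) \<in> G" "(INF w\<in>{w. (x, w) \<in> G}. ereal w) = ereal v"
      using ex_least_convex_hull_graph[OF S(1) q \<open>x \<in> S\<close>] by (auto simp: G_def)
    \<comment> \<open>Because the infimum \<open>v\<close> is attained in the fibre and is at least
      \<open>q x0\<close>, it equals \<open>q x0\<close> exactly when \<open>(x, q x0)\<close> lies
      in the hull.\<close>
    have "v \<le> q x0" if "(x, q x0) \<in> G"
      using that v(2) by (metis (mono_tags, lifting) INF_lower ereal_less_eq(3) mem_Collect_eq)
    then have "v = q x0 \<longleftrightarrow> (x, q x0) \<in> G"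
      using v(1) lower by (metis order_antisym)
    then show ?thesis
      using convex_hull_graph_at_minimum[of S "q x0" q x] x0(2)
      unfolding val v(2) opt sol by (simp add: G_def)
  qed
  then show ?thesis
    using global convex_envelope_eq_INF_convex_hull_graph[OF S(1) q]
    by (simp add: val G_def S_def q_def)
qed

end
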